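(* Let $q\in(0,1)$ and let $p_n(q)$ be a sequence satisfying $\mathbb{P}(\mathbf{C}_{n,p_n(q)}=1)=q$, where $\mathbf{C}_{n,p}$ is the number of connected components of the random cluster graph $\mathbf{CG}_{n,p}$. Then, as $n\to\infty$, $$p_n(q)=\frac12+\frac{\log n}{2n}+O\left(\frac{\log\log n}{n}\right).$$
   Context: A cluster graph is a simple undirected graph on the labelled vertex set $\{1,\dots,n\}$ every connected component of which is a complete graph. For $p\in(0,1)$, the random cluster graph $\mathbf{CG}_{n,p}$ is the Erdős–Rényi random graph on $n$ vertices with edge probability $p$ (each of the $\binom n2$ edges present independently with probability $p$), conditioned on the event that it is a cluster graph. For each $n\ge2$ the function $p\mapsto\mathbb{P}(\mathbf{C}_{n,p}=1)$ is strictly increasing and continuous, so $p_n(q)\in(0,1)$ exists and is unique for every $n\geq 2$. *)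

theory Defs
  imports "HOL-Probability.Probability" "HOL-Library.Landau_Symbols"
begin

text \<open>A simple graph on the labelled vertex set \<open>{1..n}\<close> is represented by its set of edges,
  each edge being a two-element set of vertices.\<close>

type_synonym edges = "nat set set"

definition all_edges :: "nat \<Rightarrow> edges" where
  "all_edges n = {e. e \<subseteq> {1..n} \<and> card e = 2}"

definition connected_rel :: "nat \<Rightarrow> edges \<Rightarrow> (nat \<times> nat) set" where
  "connected_rel n E = {(u, v). u \<in> {1..n} \<and> v \<in> {1..n} \<and> (u, v) \<in> {(x, y). {x, y} \<in> E}\<^sup>*}"

text \<open>Components are given by their vertex sets; isolated vertices form components of their own.\<close>

definition components_of_graph :: "nat \<Rightarrow> edges \<Rightarrow> nat set set" where
  "components_of_graph n E = {1..n} // connected_rel n E"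

definition num_components :: "nat \<Rightarrow> edges \<Rightarrow> nat" where
  "num_components n E = card (components_of_graph n E)"

definition is_cluster_graph :: "nat \<Rightarrow> edges \<Rightarrow> bool" where
  "is_cluster_graph n E \<longleftrightarrow>
     E \<subseteq> all_edges n \<and>
     (\<forall>C \<in> components_of_graph n E. \<forall>u \<in> C. \<forall>v \<in> C. u \<noteq> v \<longrightarrow> {u, v} \<in> E)"

definition erdos_renyi :: "nat \<Rightarrow> real \<Rightarrow> edges pmf" where
  "erdos_renyi n p =
     map_pmf (\<lambda>X. {e \<in> all_edges n. X e})
       (Pi_pmf (all_edges n) False (\<lambda>_. bernoulli_pmf p))"

definition random_cluster_graph :: "nat \<Rightarrow> real \<Rightarrow> edges pmf" where
  "random_cluster_graph n p = cond_pmf (erdos_renyi n p) {E. is_cluster_graph n E}"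

lemma finite_all_edges: "finite (all_edges n)"
  by (rule finite_subset[of _ "Pow {1..n}"]) (auto simp: all_edges_def)

lemma is_cluster_graph_empty: "is_cluster_graph n {}"
  by (auto simp: is_cluster_graph_def components_of_graph_def connected_rel_def quotient_def)

text \<open>The operation \<open>cond_pmf\<close> is only meaningful when the conditioning event meets the
  support, which is the case here because the graph without edges is a cluster graph.\<close>

lemma erdos_renyi_cluster_nonempty:
  assumes "0 < p" "p < 1"
  shows "set_pmf (erdos_renyi n p) \<inter> {E. is_cluster_graph n E} \<noteq> {}"
proof -
  have "(\<lambda>_. False) \<in> set_pmf (Pi_pmf (all_edges n) False (\<lambda>_. bernoulli_pmf p))"
    using assms by (subst set_Pi_pmf[OF finite_all_edges]) (auto simp: PiE_dflt_def)
  then have "{} \<in> set_pmf (erdos_renyi n p)"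
    by (auto simp: erdos_renyi_def image_iff intro!: bexI[of _ "\<lambda>_. False"])
  then show ?thesis
    using is_cluster_graph_empty by blast
qed

end

theory Submission
  imports Defs "HOL-Real_Asymp.Real_Asymp"
begin

text \<open>
  With \<open>L = ln (p / (1 - p))\<close> every cluster graph \<open>E\<close> has weight proportional to \<open>exp (L |E|)\<close>, and
  the complete graph is the only connected one, so \<open>q \<Sum>\<^sub>E exp (L |E|) = exp (L N)\<close> where
  \<open>N = n choose 2\<close>.
  Counting set partitions for which \<open>1, \<dots>, k\<close> lie in distinct blocks and every block meets
  \<open>{1..k}\<close> gives at least \<open>k\<^bsup>n - k\<^esup>\<close> cluster graphs; taking \<open>k \<approx> n / ln n\<close> this forces
  \<open>L \<ge> 2 ln n / n - O(ln (ln n) / n)\<close>.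
  Conversely, a cluster graph whose largest block has \<open>n - k\<close> vertices misses at least \<open>n k / 2\<close>
  edges, and there are at most \<open>(n choose k) k\<^bsup>k\<^esup> \<le> (e n)\<^bsup>k\<^esup>\<close> such graphs, so \<open>1 / q\<close> is bounded by the
  geometric series with ratio \<open>e n exp (- L n / 2)\<close> and hence \<open>L \<le> 2 ln n / n + O(1 / n)\<close>.
\<close>

section \<open>Cluster graphs as equivalence relations\<close>

lemma card_all_edges: "card (all_edges n) = n choose 2"
  unfolding all_edges_def using n_subsets[of "{1..n}" 2] by simp

lemma card_le_all_edges: "E \<subseteq> all_edges n \<Longrightarrow> card E \<le> n choose 2"
  using card_mono[OF finite_all_edges] card_all_edges by metis

lemma pair_in_all_edges: "{u, v} \<in> all_edges n \<longleftrightarrow> u \<in> {1..n} \<and> v \<in> {1..n} \<and> u \<noteq> v"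
  by (auto simp: all_edges_def card_insert_if)

lemma all_edges_E:
  assumes "e \<in> all_edges n"
  obtains u v where "e = {u, v}" "u \<in> {1..n}" "v \<in> {1..n}" "u \<noteq> v"
  using assms by (auto simp: all_edges_def card_2_iff)

lemma equiv_connected_rel: "equiv {1..n} (connected_rel n E)"
proof (rule equivI)
  have "sym ({(x, y). {x, y} \<in> E}\<^sup>*)"
    by (rule sym_rtrancl) (auto simp: sym_def insert_commute)
  then show "sym (connected_rel n E)"
    by (auto simp: connected_rel_def sym_def)
  show "trans (connected_rel n E)"
    by (rule transI) (auto simp: connected_rel_def)
  show "connected_rel n E \<subseteq> {1..n} \<times> {1..n}"
    by (auto simp: connected_rel_def)
  show "refl_on {1..n} (connected_rel n E)"
    by (auto simp: connected_rel_def refl_on_def)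
qed

lemma connected_rel_edge:
  assumes "E \<subseteq> all_edges n" "{u, v} \<in> E"
  shows "(u, v) \<in> connected_rel n E"
  using assms pair_in_all_edges by (auto simp: connected_rel_def)

text \<open>Two vertices share a class exactly when they are related. Quantifiers over the quotient
  can thus be traded for quantifiers over pairs.\<close>

lemma ball_components_of_graph_iff:
  "(\<forall>C \<in> components_of_graph n E. \<forall>u \<in> C. \<forall>v \<in> C. P u v)
     \<longleftrightarrow> (\<forall>u v. (u, v) \<in> connected_rel n E \<longrightarrow> P u v)" (is "?L \<longleftrightarrow> ?R")
proof
  assume L: ?L
  show ?R
  proof (intro allI impI)
    fix u v assume uv: "(u, v) \<in> connected_rel n E"
    then have "u \<in> {1..n}" by (auto simp: connected_rel_def)
    then have C: "connected_rel n E `` {u} \<in> components_of_graph n E"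
      unfolding components_of_graph_def by (rule quotientI)
    have u: "u \<in> connected_rel n E `` {u}"
      by (rule equiv_class_self[OF equiv_connected_rel \<open>u \<in> {1..n}\<close>])
    have v: "v \<in> connected_rel n E `` {u}" using uv by simp
    show "P u v" using L[THEN bspec, OF C, THEN bspec, OF u, THEN bspec, OF v] .
  qed
next
  assume R: ?R
  have "(u, v) \<in> connected_rel n E"
    if "C \<in> components_of_graph n E" "u \<in> C" "v \<in> C" for C u v
    using in_quotient_imp_in_rel[OF equiv_connected_rel, of C n E u v] that
    by (simp add: components_of_graph_def)
  with R show ?L by blast
qed

lemma is_cluster_graph_iff:
  "is_cluster_graph n E \<longleftrightarrow>
     E \<subseteq> all_edges n \<and> (\<forall>u v. (u, v) \<in> connected_rel n E \<longrightarrow> u \<noteq> v \<longrightarrow> {u, v} \<in> E)"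
  unfolding is_cluster_graph_def ball_components_of_graph_iff ..

text \<open>Along a path, transitivity contracts the edges one by one into a single edge, so no
  reachability closure is left to handle. This is the form in which graphs are later checked to be
  cluster graphs.\<close>

lemma is_cluster_graph_iff_trans:
  "is_cluster_graph n E \<longleftrightarrow>
     E \<subseteq> all_edges n \<and> (\<forall>u v w. {u, v} \<in> E \<longrightarrow> {v, w} \<in> E \<longrightarrow> u \<noteq> w \<longrightarrow> {u, w} \<in> E)"
    (is "_ \<longleftrightarrow> _ \<and> ?T")
proof
  assume "is_cluster_graph n E"
  then have E: "E \<subseteq> all_edges n"
    and cl: "\<And>u v. (u, v) \<in> connected_rel n E \<Longrightarrow> u \<noteq> v \<Longrightarrow> {u, v} \<in> E"
    by (auto simp: is_cluster_graph_iff)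
  have ?T
    using cl connected_rel_edge[OF E] equiv_connected_rel[of n E] by (meson equivE transE)
  with E show "E \<subseteq> all_edges n \<and> ?T" by blast
next
  assume *: "E \<subseteq> all_edges n \<and> ?T"
  have "u = v \<or> {u, v} \<in> E" if "(u, v) \<in> {(x, y). {x, y} \<in> E}\<^sup>*" for u v
    using that by induction (use * in auto)
  with * show "is_cluster_graph n E"
    by (auto simp: is_cluster_graph_iff connected_rel_def)
qed

text \<open>A single class must be all of \<open>{1..n}\<close>, and classes are cliques. The case
  \<open>n = 0\<close> has to be excluded: the empty graph is then complete but has no
  component.\<close>

lemma num_components_cluster_graph_eq_1_iff:
  assumes "n \<ge> 1" "is_cluster_graph n E"
  shows "num_components n E = 1 \<longleftrightarrow> E = all_edges n"
proof
  assume "num_components n E = 1"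
  then obtain C where C: "components_of_graph n E = {C}"
    unfolding num_components_def by (metis card_1_singletonE)
  then have "C = {1..n}"
    using Union_quotient[OF equiv_connected_rel[of n E]] by (simp add: components_of_graph_def)
  with C assms have "\<And>u v. u \<in> {1..n} \<Longrightarrow> v \<in> {1..n} \<Longrightarrow> u \<noteq> v \<Longrightarrow> {u, v} \<in> E"
    by (simp add: is_cluster_graph_def)
  then have "all_edges n \<subseteq> E" by (auto elim!: all_edges_E)
  with assms show "E = all_edges n" by (auto simp: is_cluster_graph_def)
next
  assume E: "E = all_edges n"
  have "(u, v) \<in> connected_rel n E" if "u \<in> {1..n}" "v \<in> {1..n}" for u v
    using that connected_rel_edge[of E n u v] equiv_class_self[OF equiv_connected_rel, of u n E]
    by (cases "u = v") (auto simp: E pair_in_all_edges)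
  then have "connected_rel n E = {1..n} \<times> {1..n}"
    by (auto simp: connected_rel_def)
  then have "components_of_graph n E = {{1..n}}"
    using assms(1) by (auto simp: components_of_graph_def quotient_def)
  then show "num_components n E = 1" by (simp add: num_components_def)
qed

lemma finite_cluster_graphs: "finite {E. is_cluster_graph n E}"
  by (rule finite_subset[of _ "Pow (all_edges n)"])
     (auto simp: is_cluster_graph_def finite_all_edges)

lemma is_cluster_graph_all_edges: "is_cluster_graph n (all_edges n)"
  unfolding is_cluster_graph_iff_trans by (simp add: pair_in_all_edges)

section \<open>The probability of being connected\<close>

text \<open>Pulling \<open>1 - p\<close> out for every potential edge leaves the odds
  \<open>p / (1 - p)\<close> once per present edge. The prefactor does not depend on
  \<open>E\<close>, so it cancels under conditioning.\<close>

lemma pmf_erdos_renyi: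
  assumes "0 < p" "p < 1" "E \<subseteq> all_edges n"
  shows "pmf (erdos_renyi n p) E = (1 - p) ^ (n choose 2) * exp (ln (p / (1 - p)) * card E)"
proof -
  let ?A = "all_edges n" and ?f = "\<lambda>X. {e \<in> all_edges n. X e}"
  let ?M = "Pi_pmf ?A False (\<lambda>_. bernoulli_pmf p)"
  let ?X = "\<lambda>e. e \<in> E"
  \<comment> \<open>The default value \<open>False\<close> outside \<open>all_edges n\<close> makes
    an indicator in the support recoverable from its edge set.\<close>
  have inj: "inj_on ?f (set_pmf ?M)"
  proof (rule inj_onI)
    fix X Y assume X: "X \<in> set_pmf ?M" and Y: "Y \<in> set_pmf ?M" and eq: "?f X = ?f Y"
    show "X = Y"
    proof
      fix e
      have "\<not> X e \<and> \<not> Y e" if "e \<notin> ?A"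
        using that X Y set_Pi_pmf_subset[OF finite_all_edges, of n False "\<lambda>_. bernoulli_pmf p"] by auto
      moreover have "X e = Y e" if "e \<in> ?A"
        using that eq by blast
      ultimately show "X e = Y e" by blast
    qed
  qed
  have X: "?X \<in> set_pmf ?M"
    using assms by (subst set_Pi_pmf[OF finite_all_edges]) (auto simp: PiE_dflt_def)
  have "?f ?X = E" using assms by auto
  then have "pmf (erdos_renyi n p) E = pmf ?M ?X"
    using pmf_map_inj[OF inj X] by (simp add: erdos_renyi_def)
  also have "\<dots> = (\<Prod>e\<in>?A. pmf (bernoulli_pmf p) (?X e))"
    using assms by (subst pmf_Pi'[OF finite_all_edges]) auto
  also have "\<dots> = (\<Prod>e\<in>?A. (1 - p) * (if e \<in> E then p / (1 - p) else 1))"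
    using assms by (intro prod.cong) auto
  also have "\<dots> = (1 - p) ^ (n choose 2) * (p / (1 - p)) ^ card E"
    using assms(3)
    by (simp add: prod.distrib card_all_edges prod.If_cases[OF finite_all_edges] Int_absorb1)
  also have "(p / (1 - p)) ^ card E = exp (ln (p / (1 - p)) * card E)"
    using assms by (simp add: mult.commute exp_of_nat_mult)
  finally show ?thesis .
qed

text \<open>The conditional probability is the weight of the complete graph over the partition
  function; the product form clears the denominator.\<close>

lemma prob_connected_random_cluster_graph:
  assumes "0 < p" "p < 1" "n \<ge> 1"
  defines "L \<equiv> ln (p / (1 - p))"
  shows "measure_pmf.prob (random_cluster_graph n p) {E. num_components n E = 1}
           * (\<Sum>E | is_cluster_graph n E. exp (L * card E)) = exp (L * (n choose 2))"
proof -
  let ?K = "{E. is_cluster_graph n E}" and ?M = "erdos_renyi n p"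
  have ne: "set_pmf ?M \<inter> ?K \<noteq> {}"
    using erdos_renyi_cluster_nonempty assms by blast
  have K: "measure_pmf.prob ?M ?K = (1 - p) ^ (n choose 2) * (\<Sum>E\<in>?K. exp (L * card E))"
    unfolding measure_measure_pmf_finite[OF finite_cluster_graphs] sum_distrib_left L_def
    by (rule sum.cong) (use assms pmf_erdos_renyi is_cluster_graph_def in auto)
  \<comment> \<open>The event is first cut down to the support, since having one component is known
    to single out the complete graph only among cluster graphs.\<close>
  have "measure_pmf.prob (random_cluster_graph n p) {E. num_components n E = 1}
    = measure_pmf.prob (random_cluster_graph n p)
        (set_pmf (random_cluster_graph n p) \<inter> {E. num_components n E = 1})"
    by (rule measure_pmf.finite_measure_eq_AE) (auto simp: AE_measure_pmf_iff)
  also have "set_pmf (random_cluster_graph n p) \<inter> {E. num_components n E = 1}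
    = set_pmf (random_cluster_graph n p) \<inter> {all_edges n}"
    using num_components_cluster_graph_eq_1_iff[of n] is_cluster_graph_all_edges[of n] assms(3)
    by (auto simp: random_cluster_graph_def set_cond_pmf[OF ne])
  also have "measure_pmf.prob (random_cluster_graph n p) \<dots> =
    measure_pmf.prob (random_cluster_graph n p) {all_edges n}"
    by (rule measure_pmf.finite_measure_eq_AE) (auto simp: AE_measure_pmf_iff)
  also have "\<dots> = pmf ?M (all_edges n) / measure_pmf.prob ?M ?K"
    by (simp add: random_cluster_graph_def measure_pmf_single pmf_cond[OF ne]
        is_cluster_graph_all_edges)
  also have "\<dots> * (\<Sum>E\<in>?K. exp (L * card E)) = exp (L * (n choose 2))"
  proof -
    have "(\<Sum>E\<in>?K. exp (L * card E)) > 0"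
      using is_cluster_graph_empty
      by (intro sum_pos finite_cluster_graphs) auto
    then show ?thesis
      using assms by (simp add: K pmf_erdos_renyi card_all_edges L_def)
  qed
  finally show ?thesis .
qed

section \<open>Many cluster graphs\<close>

text \<open>Each vertex above \<open>k\<close> freely picks one of \<open>1, ..., k\<close> to join.
  The choice can be read off the graph, because such a vertex is adjacent to exactly one vertex of
  \<open>{1..k}\<close>.\<close>

lemma card_cluster_graphs_ge:
  assumes "k \<le> n"
  shows "k ^ (n - k) \<le> card {E. is_cluster_graph n E}"
proof -
  define F where "F f i = (if i \<le> k then i else f i)" for f :: "nat \<Rightarrow> nat" and i
  define G where "G f = {{u, v} |u v. u \<in> {1..n} \<and> v \<in> {1..n} \<and> u \<noteq> v \<and> F f u = F f v}" for f
  have G_iff: "{u, v} \<in> G f \<longleftrightarrow> u \<in> {1..n} \<and> v \<in> {1..n} \<and> u \<noteq> v \<and> F f u = F f v" for u v f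
    by (auto simp: G_def doubleton_eq_iff)
  let ?S = "{k<..n} \<rightarrow>\<^sub>E {1..k}"
  have "is_cluster_graph n (G f)" for f
    unfolding is_cluster_graph_iff_trans G_iff by (auto simp: G_def pair_in_all_edges)
  moreover have "inj_on G ?S"
  proof (rule inj_onI)
    fix f g assume f: "f \<in> ?S" and g: "g \<in> ?S" and eq: "G f = G g"
    show "f = g"
    proof (rule PiE_ext[OF f g])
      fix i assume i: "i \<in> {k<..n}"
      with f have "f i \<in> {1..k}" by auto
      with i assms have "{i, f i} \<in> G f" by (auto simp: G_iff F_def)
      with eq have "{i, f i} \<in> G g" by simp
      with i \<open>f i \<in> {1..k}\<close> show "f i = g i" by (auto simp: G_iff F_def)
    qed
  qed
  ultimately have "card ?S \<le> card {E. is_cluster_graph n E}"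
    by (intro card_inj_on_le[of G]) (auto simp: finite_cluster_graphs)
  then show ?thesis by (simp add: card_PiE)
qed

section \<open>Few cluster graphs with a large block\<close>

text \<open>The quotient of \<open>k ^ k\<close> by \<open>fact k\<close> is one term of the
  exponential series at \<open>k\<close>.\<close>

lemma pow_self_le_exp_fact: "real k ^ k \<le> exp k * fact k"
proof -
  have "real k ^ k / fact k \<le> exp (real k)"
    using sum_le_suminf[OF summable_exp[of "real k"], of "{k}"]
    by (simp add: exp_def divide_inverse mult.commute)
  then show ?thesis by (simp add: field_simps)
qed

lemma binomial_mult_pow_self_le: "real (n choose k) * real k ^ k \<le> (exp 1 * n) ^ k"
proof -
  have "real (n choose k) * real k ^ k \<le> real (n choose k) * (exp k * fact k)"
    by (intro mult_left_mono pow_self_le_exp_fact) auto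
  also have "\<dots> = exp k * real ((n choose k) * fact k)" by simp
  also have "\<dots> \<le> exp k * real (n ^ k)"
    by (intro mult_left_mono) (simp_all only: of_nat_le_iff binomial_fact_pow exp_ge_zero)
  also have "\<dots> = (exp 1 * n) ^ k"
    using exp_of_nat_mult[of k "1::real"] by (simp add: power_mult_distrib)
  finally show ?thesis .
qed

section \<open>Blocks and the encoding of cluster graphs\<close>

text \<open>This is the closed neighbourhood of \<open>v\<close>; in a cluster graph it is the
  component of \<open>v\<close>, available without any reachability.\<close>

definition block :: "nat \<Rightarrow> edges \<Rightarrow> nat \<Rightarrow> nat set" where
  "block n E v = {u \<in> {1..n}. u = v \<or> {u, v} \<in> E}"

lemma block_eq:
  assumes "is_cluster_graph n E" "v \<in> {1..n}" "u \<in> block n E v"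
  shows "block n E u = block n E v"
proof -
  have tr: "\<And>u v w. {u, v} \<in> E \<Longrightarrow> {v, w} \<in> E \<Longrightarrow> u \<noteq> w \<Longrightarrow> {u, w} \<in> E"
    using assms(1) unfolding is_cluster_graph_iff_trans by blast
  show ?thesis
    using assms(2,3) tr unfolding block_def
    by (auto simp: insert_commute) (metis insert_commute)+
qed

text \<open>Handshake argument: a vertex has degree one less than the size of its closed
  neighbourhood.\<close>

lemma twice_card_edges_le:
  assumes E: "E \<subseteq> all_edges n" and b: "\<And>v. v \<in> {1..n} \<Longrightarrow> card (block n E v) \<le> b"
  shows "2 * card E \<le> n * (b - 1)"
proof -
  have fin: "finite E" using E finite_all_edges finite_subset by blast
  have "(\<Sum>v\<in>{1..n}. card {e\<in>E. v \<in> e}) = 2 * card E"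
  proof (rule sum_multicount)
    show "\<forall>e\<in>E. card {v \<in> {1..n}. v \<in> e} = 2"
    proof
      fix e assume "e \<in> E"
      with E have "e \<subseteq> {1..n}" "card e = 2" by (auto simp: all_edges_def)
      then show "card {v \<in> {1..n}. v \<in> e} = 2"
        by (metis Collect_mem_eq Int_absorb1 Int_def)
    qed
  qed (use fin in auto)
  moreover have "card {e\<in>E. v \<in> e} \<le> b - 1" if v: "v \<in> {1..n}" for v
  proof -
    have "{e\<in>E. v \<in> e} \<subseteq> (\<lambda>u. {u, v}) ` (block n E v - {v})"
    proof
      fix e assume e: "e \<in> {e\<in>E. v \<in> e}"
      then obtain x y where xy: "e = {x, y}" "x \<in> {1..n}" "y \<in> {1..n}" "x \<noteq> y"
        using E all_edges_E by blast
      have "{x, y} \<in> E" "v = x \<or> v = y" using e xy(1) by auto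
      then obtain u where "e = {u, v}" "u \<in> block n E v - {v}"
        using xy by (auto simp: block_def insert_commute)
      then show "e \<in> (\<lambda>u. {u, v}) ` (block n E v - {v})" by simp
    qed
    moreover have "finite (block n E v)" by (simp add: block_def)
    ultimately have "card {e\<in>E. v \<in> e} \<le> card (block n E v - {v})"
      by (meson finite_Diff surj_card_le)
    also have "\<dots> = card (block n E v) - 1"
      using v by (simp add: block_def)
    finally show ?thesis using b[OF v] by linarith
  qed
  then have "(\<Sum>v\<in>{1..n}. card {e\<in>E. v \<in> e}) \<le> (\<Sum>v\<in>{1..n}. b - 1)"
    by (rule sum_mono)
  ultimately show ?thesis by simp
qed

lemma edge_iff_block_eq:
  assumes "is_cluster_graph n E" "u \<in> {1..n}" "v \<in> {1..n}" "u \<noteq> v"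
  shows "{u, v} \<in> E \<longleftrightarrow> block n E u = block n E v"
proof
  assume "{u, v} \<in> E"
  with assms have "u \<in> block n E v" by (simp add: block_def)
  with assms show "block n E u = block n E v" by (intro block_eq)
next
  assume "block n E u = block n E v"
  moreover have "u \<in> block n E u" using assms by (simp add: block_def)
  ultimately have "u \<in> block n E v" by simp
  with assms show "{u, v} \<in> E" by (simp add: block_def)
qed

text \<open>Outside \<open>T\<close> lies one clique; inside \<open>T\<close> the cliques are the
  fibres of \<open>g\<close>. Several \<open>g\<close> may code the same graph, which is harmless
  for an upper bound on the count.\<close>

definition coded_graph :: "nat \<Rightarrow> nat set \<Rightarrow> (nat \<Rightarrow> nat) \<Rightarrow> edges" where
  "coded_graph n T g = {{u, v} |u v. u \<in> {1..n} \<and> v \<in> {1..n} \<and> u \<noteq> v \<and>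
     (u \<notin> T \<and> v \<notin> T \<or> u \<in> T \<and> v \<in> T \<and> g u = g v)}"

text \<open>A largest block \<open>S\<close> is encoded by its complement \<open>T\<close>; the other blocks partition \<open>T\<close>
  and are encoded by the map that sends a vertex to the least element of its block.\<close>

lemma cluster_graph_encoding:
  assumes cl: "is_cluster_graph n E" and n: "n \<ge> 1"
  obtains T g where "T \<subseteq> {1..n}" "card T < n" "g \<in> T \<rightarrow>\<^sub>E T" "E = coded_graph n T g"
    "2 * card E \<le> n * (n - 1 - card T)"
proof -
  let ?b = "\<lambda>v. card (block n E v)"
  have E: "E \<subseteq> all_edges n" using cl by (simp add: is_cluster_graph_def)
  have "Max (?b ` {1..n}) \<in> ?b ` {1..n}" using n by (intro Max_in) auto
  then obtain v0 where v0: "v0 \<in> {1..n}" and "?b v0 = Max (?b ` {1..n})" by auto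
  then have max: "?b v \<le> ?b v0" if "v \<in> {1..n}" for v using that by simp
  define S where "S = block n E v0"
  define T where "T = {1..n} - S"
  define g where "g = restrict (\<lambda>v. Min (block n E v)) T"
  have self: "v \<in> block n E v" if "v \<in> {1..n}" for v using that by (simp add: block_def)
  have sub: "block n E v \<subseteq> {1..n}" for v by (auto simp: block_def)
  have fin: "finite (block n E v)" for v by (simp add: block_def)
  have S: "S \<subseteq> {1..n}" "v0 \<in> S" using self[OF v0] sub by (auto simp: S_def)
  have S_iff: "v \<in> S \<longleftrightarrow> block n E v = S" if "v \<in> {1..n}" for v
    using that self[of v] block_eq[OF cl v0, of v] unfolding S_def by blast
  have cT: "card T = n - card S"
    using S fin by (simp add: T_def card_Diff_subset S_def)
  have cS: "card S \<ge> 1" "card S \<le> n"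
    using S fin[of v0] card_mono[OF _ S(1)] by (auto simp: S_def Suc_le_eq card_gt_0_iff)
  have Min: "Min (block n E v) \<in> block n E v" if "v \<in> {1..n}" for v
    using that self fin by (intro Min_in) auto
  \<comment> \<open>The least element of a block has that same block, hence cannot fall into
    \<open>S\<close>.\<close>
  have gT: "Min (block n E v) \<in> T" if v: "v \<in> T" for v
  proof -
    have v': "v \<in> {1..n}" "v \<notin> S" using v by (auto simp: T_def)
    have "block n E (Min (block n E v)) = block n E v"
      by (rule block_eq[OF cl v'(1) Min[OF v'(1)]])
    moreover have "Min (block n E v) \<in> {1..n}" using Min[OF v'(1)] sub by blast
    ultimately show ?thesis using S_iff v' by (simp add: T_def)
  qed
  have g_iff: "g u = g v \<longleftrightarrow> block n E u = block n E v" if u: "u \<in> T" and v: "v \<in> T" for u v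
  proof
    assume "g u = g v"
    then have eq: "Min (block n E u) = Min (block n E v)" using u v by (simp add: g_def)
    have uv: "u \<in> {1..n}" "v \<in> {1..n}" using u v by (auto simp: T_def)
    show "block n E u = block n E v"
      using block_eq[OF cl uv(1) Min[OF uv(1)]] block_eq[OF cl uv(2) Min[OF uv(2)]]
      unfolding eq by (rule box_equals[OF refl])
  qed (use u v in \<open>simp add: g_def\<close>)
  have pair: "{u, v} \<in> E \<longleftrightarrow> u \<notin> T \<and> v \<notin> T \<or> u \<in> T \<and> v \<in> T \<and> g u = g v"
    if "u \<in> {1..n}" "v \<in> {1..n}" "u \<noteq> v" for u v
  proof -
    have "u \<in> T \<longleftrightarrow> block n E u \<noteq> S" "v \<in> T \<longleftrightarrow> block n E v \<noteq> S"
      using that S_iff by (auto simp: T_def)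
    then show ?thesis
      using edge_iff_block_eq[OF cl that] g_iff[of u v] by auto
  qed
  show ?thesis
  proof
    show "T \<subseteq> {1..n}" by (auto simp: T_def)
    show "card T < n" using cT cS by simp
    show "g \<in> T \<rightarrow>\<^sub>E T" using gT by (simp add: g_def)
    \<comment> \<open>Maximality of \<open>S\<close> enters here: every block has at most
      \<open>card S = n - card T\<close> elements.\<close>
    show "2 * card E \<le> n * (n - 1 - card T)"
      using twice_card_edges_le[OF E max] cT cS by (simp add: S_def)
    show "E = coded_graph n T g"
    proof (intro equalityI subsetI)
      fix e assume e: "e \<in> E"
      then obtain u v where uv: "e = {u, v}" "u \<in> {1..n}" "v \<in> {1..n}" "u \<noteq> v"
        using E all_edges_E by blast
      with e pair[OF uv(2-4)] show "e \<in> coded_graph n T g"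
        unfolding coded_graph_def by blast
    next
      fix e assume "e \<in> coded_graph n T g"
      then obtain u v where "e = {u, v}" "u \<in> {1..n}" "v \<in> {1..n}" "u \<noteq> v"
        "u \<notin> T \<and> v \<notin> T \<or> u \<in> T \<and> v \<in> T \<and> g u = g v"
        unfolding coded_graph_def by blast
      with pair[of u v] show "e \<in> E" by simp
    qed
  qed
qed

text \<open>Choose \<open>T\<close>, then one of the \<open>k ^ k\<close> self-maps of
  \<open>T\<close>. For \<open>k = 0\<close> the convention \<open>0 ^ 0 = 1\<close> counts the
  single empty map.\<close>

lemma card_coded_graphs_le:
  "card {coded_graph n T g |T g. T \<subseteq> {1..n} \<and> card T = k \<and> g \<in> T \<rightarrow>\<^sub>E T} \<le> (n choose k) * k ^ k"
  "finite {coded_graph n T g |T g. T \<subseteq> {1..n} \<and> card T = k \<and> g \<in> T \<rightarrow>\<^sub>E T}"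
proof -
  let ?D = "SIGMA T : {T. T \<subseteq> {1..n} \<and> card T = k}. T \<rightarrow>\<^sub>E T"
  have eq: "{coded_graph n T g |T g. T \<subseteq> {1..n} \<and> card T = k \<and> g \<in> T \<rightarrow>\<^sub>E T}
      = case_prod (coded_graph n) ` ?D" by auto
  have T: "finite T" if "T \<subseteq> {Suc 0..n}" for T :: "nat set"
    using that finite_subset by blast
  have fin: "finite {T. T \<subseteq> {1..n} \<and> card T = k}" by simp
  have "card ?D = (\<Sum>T | T \<subseteq> {1..n} \<and> card T = k. card (T \<rightarrow>\<^sub>E T))"
    using fin by (subst card_SigmaI) (auto intro: finite_PiE T)
  also have "\<dots> = (\<Sum>T | T \<subseteq> {1..n} \<and> card T = k. k ^ k)"
    by (intro sum.cong refl) (auto simp: card_PiE T)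
  also have "\<dots> = (n choose k) * k ^ k" using n_subsets[of "{1..n}" k] by simp
  finally have "card ?D = (n choose k) * k ^ k" .
  moreover have "finite ?D" using fin by (auto intro!: finite_SigmaI finite_PiE T)
  ultimately show
    "card {coded_graph n T g |T g. T \<subseteq> {1..n} \<and> card T = k \<and> g \<in> T \<rightarrow>\<^sub>E T} \<le> (n choose k) * k ^ k"
    "finite {coded_graph n T g |T g. T \<subseteq> {1..n} \<and> card T = k \<and> g \<in> T \<rightarrow>\<^sub>E T}"
    unfolding eq using card_image_le[of ?D] by auto
qed

lemma real_choose_two: "real (n choose 2) = real n * (real n - 1) / 2"
  by (simp add: choose_two real_of_nat_div algebra_simps of_nat_diff)

section \<open>Geometric bound for the partition function\<close>

text \<open>Graphs are grouped by the size \<open>k\<close> of the coded complement. Each group has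
  at most \<open>(exp 1 * n) ^ k\<close> members, and each member misses at least
  \<open>n * k / 2\<close> edges, costing a factor \<open>exp (- L * n / 2) ^ k\<close>.\<close>

lemma cluster_weight_sum_le:
  fixes L :: real
  assumes L: "L \<ge> 0" and n: "n \<ge> 1"
  shows "(\<Sum>E | is_cluster_graph n E. exp (L * card E))
    \<le> exp (L * (n choose 2)) * (\<Sum>k<n. (exp 1 * n * exp (- L * n / 2)) ^ k)"
proof -
  let ?K = "{E. is_cluster_graph n E}"
  let ?w = "\<lambda>k. exp (L * (n choose 2)) * exp (- L * n / 2) ^ k"
  let ?C = "\<lambda>k. {coded_graph n T g |T g. T \<subseteq> {1..n} \<and> card T = k \<and> g \<in> T \<rightarrow>\<^sub>E T}"
  have "\<exists>k. k < n \<and> E \<in> ?C k \<and> 2 * card E \<le> n * (n - 1 - k)" if "E \<in> ?K" for E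
  proof -
    from that have "is_cluster_graph n E" by simp
    from cluster_graph_encoding[OF this n] obtain T g where "T \<subseteq> {1..n}" "card T < n"
      "g \<in> T \<rightarrow>\<^sub>E T" "E = coded_graph n T g" "2 * card E \<le> n * (n - 1 - card T)" .
    then show ?thesis by (intro exI[of _ "card T"]) blast
  qed
  then have "\<forall>E\<in>?K. \<exists>k. k < n \<and> E \<in> ?C k \<and> 2 * card E \<le> n * (n - 1 - k)" by (rule ballI)
  \<comment> \<open>A graph may admit codes of different sizes; fixing one size per graph makes the
    groups disjoint.\<close>
  from bchoice[OF this] obtain \<kappa> where
    "\<forall>E\<in>?K. \<kappa> E < n \<and> E \<in> ?C (\<kappa> E) \<and> 2 * card E \<le> n * (n - 1 - \<kappa> E)" ..
  then have \<kappa>: "\<kappa> E < n" "E \<in> ?C (\<kappa> E)" "2 * card E \<le> n * (n - 1 - \<kappa> E)"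
    if "E \<in> ?K" for E
    using that by (elim ballE; (elim conjE)?; blast)+
  have w: "exp (L * card E) \<le> ?w (\<kappa> E)" if E: "E \<in> ?K" for E
  proof -
    have "2 * real (card E) \<le> real (n * (n - 1 - \<kappa> E))"
      using \<kappa>(3)[OF E] by (metis of_nat_le_iff of_nat_mult of_nat_numeral)
    also have "\<dots> = real n * (real n - 1 - \<kappa> E)"
      using \<kappa>(1)[OF E] by (simp add: of_nat_diff)
    finally have "real (card E) \<le> (n choose 2) - real n * \<kappa> E / 2"
      by (simp add: real_choose_two algebra_simps)
    from mult_left_mono[OF this L]
    have "exp (L * card E) \<le> exp (L * (n choose 2) + \<kappa> E * (- L * n / 2))"
      by (simp add: algebra_simps)
    then show ?thesis by (simp only: exp_add exp_of_nat_mult)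
  qed
  have "(\<Sum>E\<in>?K. exp (L * card E)) = (\<Sum>k<n. \<Sum>E\<in>{E\<in>?K. \<kappa> E = k}. exp (L * card E))"
    by (rule sum.group[symmetric]) (use \<kappa>(1) finite_cluster_graphs in auto)
  also have "\<dots> \<le> (\<Sum>k<n. (exp 1 * n) ^ k * ?w k)"
  proof (rule sum_mono)
    fix k
    have "(\<Sum>E\<in>{E\<in>?K. \<kappa> E = k}. exp (L * card E)) \<le> (\<Sum>E\<in>{E\<in>?K. \<kappa> E = k}. ?w k)"
      by (rule sum_mono) (use w in auto)
    also have "\<dots> = card {E\<in>?K. \<kappa> E = k} * ?w k" by simp
    also have "card {E\<in>?K. \<kappa> E = k} \<le> card (?C k)"
      using \<kappa>(2) by (intro card_mono card_coded_graphs_le) blast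
    then have "card {E\<in>?K. \<kappa> E = k} \<le> (n choose k) * k ^ k"
      using card_coded_graphs_le(1)[of n k] by linarith
    then have "real (card {E\<in>?K. \<kappa> E = k}) \<le> real (n choose k) * real k ^ k"
      by (metis of_nat_le_iff of_nat_mult of_nat_power)
    also note binomial_mult_pow_self_le
    finally show "(\<Sum>E\<in>{E\<in>?K. \<kappa> E = k}. exp (L * card E)) \<le> (exp 1 * n) ^ k * ?w k"
      by (simp add: mult_right_mono)
  qed
  also have "\<dots> = exp (L * (n choose 2)) * (\<Sum>k<n. (exp 1 * n * exp (- L * n / 2)) ^ k)"
    by (simp add: sum_distrib_left power_mult_distrib mult_ac)
  finally show ?thesis .
qed

section \<open>Bounds on the log-odds\<close>

text \<open>Once \<open>L > 0\<close> is known, every graph weighs at least 1, so the partition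
  function is at least the number of cluster graphs.\<close>

lemma log_odds_lower:
  fixes L q :: real and n k :: nat
  assumes q: "0 < q"
    and eq: "q * (\<Sum>E | is_cluster_graph n E. exp (L * card E)) = exp (L * (n choose 2))"
    and k: "1 \<le> k" "k \<le> n" and pos: "ln q + real (n - k) * ln k > 0"
  shows "L > 0" "ln q + real (n - k) * ln k \<le> L * (n choose 2)"
proof -
  let ?K = "{E. is_cluster_graph n E}"
  have "exp (ln q + real (n - k) * ln k) = q * real k ^ (n - k)"
    using q k by (simp only: exp_add exp_of_nat_mult exp_ln)
  also have "\<dots> \<le> q * card ?K"
    using card_cluster_graphs_ge[OF k(2)] q
    by (intro mult_left_mono) (simp_all flip: of_nat_power)
  finally have K: "exp (ln q + real (n - k) * ln k) \<le> q * card ?K" .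
  have gt1: "1 < exp (ln q + real (n - k) * ln k)" using pos by simp
  show "L > 0"
  \<comment> \<open>For \<open>L \<le> 0\<close> the complete graph has the smallest weight, so
    \<open>q\<close> times the number of cluster graphs would be at most 1, against
    \<open>pos\<close>.\<close>
  proof (rule ccontr)
    assume "\<not> L > 0"
    then have L: "L \<le> 0" by simp
    have "card ?K * exp (L * (n choose 2)) = (\<Sum>E\<in>?K. exp (L * (n choose 2)))" by simp
    also have "\<dots> \<le> (\<Sum>E\<in>?K. exp (L * card E))"
      using L card_le_all_edges
      by (intro sum_mono) (auto simp: is_cluster_graph_def intro!: mult_left_mono_neg)
    finally have "q * card ?K * exp (L * (n choose 2)) \<le> 1 * exp (L * (n choose 2))"
      using q by (simp add: mult_left_mono mult.assoc flip: eq)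
    then have "q * card ?K \<le> 1" by (rule mult_right_le_imp_le) simp
    with K gt1 show False by linarith
  qed
  then have "card ?K \<le> (\<Sum>E\<in>?K. exp (L * card E))"
    using sum_mono[of ?K "\<lambda>_. 1" "\<lambda>E. exp (L * card E)"] by simp
  then have "q * card ?K \<le> exp (L * (n choose 2))"
    using q by (simp add: mult_left_mono flip: eq)
  with K have "exp (ln q + real (n - k) * ln k) \<le> exp (L * (n choose 2))" by linarith
  then show "ln q + real (n - k) * ln k \<le> L * (n choose 2)" by simp
qed

lemma log_odds_upper:
  fixes L q :: real
  assumes q: "0 < q" "q < 1" and L: "L \<ge> 0" and n: "n \<ge> 1"
    and eq: "q * (\<Sum>E | is_cluster_graph n E. exp (L * card E)) = exp (L * (n choose 2))"
  shows "L \<le> 2 * (1 + ln n - ln (1 - q)) / n"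
proof -
  define t where "t = exp 1 * n * exp (- L * n / 2)"
  have t: "t > 0" using n by (simp add: t_def)
  have "1 - q \<le> t"
  \<comment> \<open>For \<open>t < 1\<close> the geometric sum is below \<open>1 / (1 - t)\<close>,
    so \<open>1 \<le> q / (1 - t)\<close>; for \<open>t \<ge> 1\<close> the claim is
    trivial.\<close>
  proof (cases "t < 1")
    case True
    have "1 * exp (L * (n choose 2)) \<le> q * (\<Sum>k<n. t ^ k) * exp (L * (n choose 2))"
      using mult_left_mono[OF cluster_weight_sum_le[OF L n], of q] q
      by (simp add: eq t_def mult_ac)
    then have "1 \<le> q * (\<Sum>k<n. t ^ k)" by (rule mult_right_le_imp_le) simp
    also have "(\<Sum>k<n. t ^ k) = (1 - t ^ n) / (1 - t)"
      using True by (simp add: sum_gp_strict)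
    also have "q * \<dots> \<le> q * (1 / (1 - t))"
      using q t True by (intro mult_left_mono divide_right_mono) auto
    finally show ?thesis using True by (simp add: field_simps)
  qed (use q in auto)
  then have "ln (1 - q) \<le> ln t" using q by simp
  also have "ln t = 1 + ln n - L * n / 2" using n by (simp add: t_def ln_mult)
  finally show ?thesis using n by (simp add: field_simps)
qed

section \<open>From log-odds back to probabilities\<close>

text \<open>The logistic function inverts the log-odds; being increasing, it carries bounds on
  \<open>L\<close> over to \<open>p\<close>.\<close>

lemma probability_eq_logistic:
  fixes p :: real
  assumes "0 < p" "p < 1"
  shows "p = 1 / (1 + exp (- ln (p / (1 - p))))"
proof -
  have "exp (- ln (p / (1 - p))) = (1 - p) / p"
    using assms by (simp add: exp_minus)
  then have "1 + exp (- ln (p / (1 - p))) = 1 / p"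
    using assms by (simp add: diff_divide_distrib)
  then show ?thesis by simp
qed

theorem theorem1p5:
  fixes q :: real and p :: "nat \<Rightarrow> real"
  assumes "0 < q" and "q < 1"
    and "\<And>n. n \<ge> 2 \<Longrightarrow> 0 < p n \<and> p n < 1"
    and "\<And>n. n \<ge> 2 \<Longrightarrow>
           measure_pmf.prob (random_cluster_graph n (p n)) {E. num_components n E = 1} = q"
  shows "(\<lambda>n. p n - (1 / 2 + ln (real n) / (2 * real n)))
           \<in> O(\<lambda>n. ln (ln (real n)) / real n)"
proof -
  define L where "L n = ln (p n / (1 - p n))" for n
  define m where "m n = 1 / 2 + ln (real n) / (2 * real n)" for n :: nat
  \<comment> \<open>This is the exponent of the lower bound with \<open>k\<close> replaced by the
    real number \<open>n / ln n\<close>; the \<open>- 1\<close> pays for rounding \<open>k\<close>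
    up. Giving up \<open>n / ln n\<close> vertices costs about \<open>n\<close>, and shrinking the
    logarithm costs about \<open>n * ln (ln n)\<close>, which is the error allowed.\<close>
  define a where "a n = ln q + (n - n / ln n - 1) * ln (n / ln n)" for n :: nat
  \<comment> \<open>Both \<open>lo\<close> and \<open>hi\<close> are explicit functions of
    \<open>n\<close>. As the logistic function is \<open>1/2 + x/4 + O(x^3)\<close> near 0, log-odds
    near \<open>2 * ln n / n\<close> produce the main term \<open>m\<close>.\<close>
  define lo where "lo n = 1 / (1 + exp (- (2 * a n / (n * (n - 1))))) - m n" for n
  define hi where "hi n = 1 / (1 + exp (- (2 * (1 + ln n - ln (1 - q)) / n))) - m n" for n :: nat
  have lo: "lo \<in> O(\<lambda>n. ln (ln (real n)) / real n)"
    unfolding lo_def a_def m_def by real_asymp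
  have hi: "hi \<in> O(\<lambda>n. ln (ln (real n)) / real n)"
    unfolding hi_def m_def by real_asymp
  have "eventually (\<lambda>n. a n > 0) at_top"
    unfolding a_def by real_asymp
  moreover have "eventually (\<lambda>n::nat. 1 < n / ln n) at_top" by real_asymp
  moreover have "eventually (\<lambda>n::nat. n / ln n + 1 < n) at_top" by real_asymp
  ultimately have "eventually (\<lambda>n. lo n \<le> p n - m n \<and> p n - m n \<le> hi n) at_top"
    using eventually_ge_at_top[of 2]
  proof eventually_elim
    case (elim n)
    have p: "0 < p n" "p n < 1" using assms(3) elim by auto
    have eq: "q * (\<Sum>E | is_cluster_graph n E. exp (L n * card E)) = exp (L n * (n choose 2))"
      using prob_connected_random_cluster_graph[OF p, of n] assms(4) elim by (simp add: L_def)
    define k where "k = nat \<lceil>n / ln n\<rceil>"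
    have k: "n / ln n \<le> k" "k \<le> n / ln n + 1"
      using elim unfolding k_def by linarith+
    have k_le: "1 \<le> k" "k \<le> n" using k elim by linarith+
    \<comment> \<open>Rounding up only increases the logarithm, while \<open>n - k\<close> drops by
      at most 1.\<close>
    have "(n - n / ln n - 1) * ln (n / ln n) \<le> real (n - k) * ln k"
    proof (rule mult_mono)
      show "n - n / ln n - 1 \<le> real (n - k)" using k k_le by (simp add: of_nat_diff)
      show "ln (n / ln n) \<le> ln k" using k elim by (intro ln_mono) linarith+
      show "0 \<le> ln (n / ln n)" by (rule ln_ge_zero) (use elim in linarith)
    qed simp
    then have a_le: "a n \<le> ln q + real (n - k) * ln k" by (simp add: a_def)
    with elim have pos: "ln q + real (n - k) * ln k > 0" by linarith
    note lower = log_odds_lower[OF assms(1) eq k_le pos]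
    have "a n \<le> L n * (real n * (real n - 1) / 2)"
      using a_le lower(2) by (simp add: real_choose_two)
    then have a: "2 * a n / (n * (n - 1)) \<le> L n"
      using elim by (simp add: of_nat_diff field_simps)
    have b: "L n \<le> 2 * (1 + ln n - ln (1 - q)) / n"
      using log_odds_upper[OF assms(1,2) _ _ eq] lower(1) elim by simp
    have pL: "p n = 1 / (1 + exp (- L n))"
      using probability_eq_logistic[OF p] by (simp add: L_def)
    have mono: "1 / (1 + exp (- x)) \<le> 1 / (1 + exp (- y))" if "x \<le> y" for x y :: real
      using that by (intro divide_left_mono) (auto simp: add_pos_pos)
    show ?case
      unfolding lo_def hi_def using mono[OF a] mono[OF b] pL by linarith
  qed
  then have "eventually (\<lambda>n. norm (p n - m n) \<le> 1 * norm (\<bar>lo n\<bar> + \<bar>hi n\<bar>)) at_top"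
    by eventually_elim auto
  then have "(\<lambda>n. p n - m n) \<in> O(\<lambda>n. \<bar>lo n\<bar> + \<bar>hi n\<bar>)" by (rule bigoI)
  also have "(\<lambda>n. \<bar>lo n\<bar> + \<bar>hi n\<bar>) \<in> O(\<lambda>n. ln (ln (real n)) / real n)"
    using lo hi by (intro sum_in_bigo) auto
  finally show ?thesis by (simp add: m_def)
qed

end
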